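(* Let $n \geq 1$, let $\mathbf{L} \in \mathbb{R}^{n\times n}$ be an invertible, non-orthogonal matrix, let $\mathbf{x}_{\rm centre} \in \mathbb{R}^n$, and put $\mathbf{S} = \mathbf{L}\mathbf{L}^T$. Let $X_{\rm ball} = \{\mathbf{x} \in \mathbb{R}^n : \|\mathbf{x}\|_2 \leq 1\}$ be the unit $n$-ball and let $$X_{\rm ellipse} = \left\{ \mathbf{x} \in \mathbb{R}^n : (\mathbf{x} - \mathbf{x}_{\rm centre})^T \mathbf{S}^{-1} (\mathbf{x} - \mathbf{x}_{\rm centre}) \leq 1 \right\}$$ be the hyperellipsoid with matrix $\mathbf{S}$ and centre $\mathbf{x}_{\rm centre}$. If $\mathbf{x}_{\rm ball}$ is a random point uniformly distributed on $X_{\rm ball}$, then the random point $$\mathbf{x}_{\rm ellipse} = \mathbf{L}\,\mathbf{x}_{\rm ball} + \mathbf{x}_{\rm centre}$$ is uniformly distributed on $X_{\rm ellipse}$.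
   Context: A random point is uniformly distributed on a (measurable) set $A \subset \mathbb{R}^n$ of positive finite volume if it has a probability density function with respect to Lebesgue measure that is constant on $A$ (equal to the reciprocal of the volume of $A$) and $0$ outside $A$. $\|\cdot\|_2$ denotes the Euclidean norm on $\mathbb{R}^n$. *)

theory Defs
  imports "HOL-Probability.Probability"
begin

definition hyperellipsoid :: "real ^ 'n ^ 'n \<Rightarrow> real ^ 'n \<Rightarrow> (real ^ 'n) set" where
  "hyperellipsoid S c = {x. (x - c) \<bullet> (matrix_inv S *v (x - c)) \<le> 1}"

(* Random points are Borel measurable, so the set A is taken to be Borel as well:
   for a set A of positive finite volume, the density below is Borel measurable
   (as required by the constant distributed) only if A is. *)
definition uniformly_distributed_on ::
  "'w measure \<Rightarrow> ('w \<Rightarrow> 'a :: euclidean_space) \<Rightarrow> 'a set \<Rightarrow> bool" where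
  "uniformly_distributed_on M X A \<longleftrightarrow>
     A \<in> sets borel \<and> 0 < emeasure lborel A \<and> emeasure lborel A < \<infinity> \<and>
     distributed M lborel X (\<lambda>x. ennreal (indicator A x / measure lborel A))"

end

theory Submission
  imports Defs
begin

text \<open>
  Under \<open>f x = L x + c\<close> with \<open>L\<close> invertible, translating the argument translates the value, so
  \<open>A \<mapsto> \<lambda>(f\<^sup>-\<^sup>1 A)\<close> is a translation-invariant measure. By the argument for uniqueness of Haar
  measure it is proportional to Lebesgue measure \<open>\<lambda>\<close>. Hence the ratios \<open>\<lambda>(C \<inter> E) / \<lambda>(E)\<close> that
  define a uniform distribution are the same for \<open>C\<close>, \<open>E\<close> as for their preimages, and the preimage
  of the ellipsoid is the unit ball. Determinants are avoided because the library's determinant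
  formula for volumes needs a well-ordered index type.
\<close>

lemma nn_integral_lborel_shift:
  fixes c :: "'a::euclidean_space"
  assumes [measurable]: "g \<in> borel_measurable borel"
  shows "(\<integral>\<^sup>+x. g (x + c) \<partial>lborel) = (\<integral>\<^sup>+x. g x \<partial>lborel)"
  by (subst (2) lborel_distr_plus[of c, symmetric])
     (simp add: nn_integral_distr add.commute)

lemma nn_integral_lborel_reflect:
  fixes c :: "'a::euclidean_space"
  assumes [measurable]: "g \<in> borel_measurable borel"
  shows "(\<integral>\<^sup>+x. g (c - x) \<partial>lborel) = (\<integral>\<^sup>+x. g x \<partial>lborel)"
proof -
  \<comment> \<open>The affine map has scaling factor \<open>-1\<close>, whose absolute value gives
    the constant density \<open>1\<close>.\<close>
  have "lborel = density (distr lborel borel (\<lambda>x::'a. c - x)) (\<lambda>_. 1)"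
    using lborel_affine[of "-1" c] by simp
  then have "distr lborel borel (\<lambda>x. c - x) = (lborel :: 'a measure)"
    by (simp add: density_1)
  then show ?thesis
    using nn_integral_distr[of "\<lambda>x. c - x" lborel borel g] by simp
qed

text \<open>
  The function \<open>h\<close> is a right inverse of the linear part of \<open>f\<close>. Both products equal the double
  integral of \<open>1\<^sub>A (f x) * 1\<^sub>B (f x + y)\<close>, by translating \<open>y\<close> by \<open>f x\<close>, or \<open>x\<close> by \<open>- h y\<close>. Stating
  proportionality as a product equation covers sets of measure \<open>0\<close> and \<open>\<infinity>\<close>.
\<close>
lemma emeasure_lborel_vimage_cross:
  fixes f :: "'a::euclidean_space \<Rightarrow> 'b::euclidean_space"
  assumes [measurable]: "f \<in> borel_measurable borel" "A \<in> sets borel" "B \<in> sets borel"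
    and shift: "\<And>x y. f (x + h y) = f x + y"
  shows "emeasure lborel (f -` A) * emeasure lborel B = emeasure lborel (f -` B) * emeasure lborel A"
proof -
  have emeasure_vimage: "emeasure lborel (f -` C) = (\<integral>\<^sup>+x. indicator C (f x) \<partial>lborel)"
    if [measurable]: "C \<in> sets borel" for C
  proof -
    have "f -` C \<in> sets borel"
      using measurable_sets[of f borel borel C] by simp
    then show ?thesis
      by (simp flip: nn_integral_indicator add: indicator_vimage)
  qed
  have [measurable]: "f \<in> borel \<rightarrow>\<^sub>M borel" by fact
  have "emeasure lborel (f -` A) * emeasure lborel B
      = (\<integral>\<^sup>+x. indicator A (f x) * (\<integral>\<^sup>+y. indicator B y \<partial>lborel) \<partial>lborel)"
    by (simp add: emeasure_vimage nn_integral_multc)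
  also have "\<dots> = (\<integral>\<^sup>+x. indicator A (f x) * (\<integral>\<^sup>+y. indicator B (y + f x) \<partial>lborel) \<partial>lborel)"
    by (subst nn_integral_lborel_shift) auto
  also have "\<dots> = (\<integral>\<^sup>+x. (\<integral>\<^sup>+y. indicator A (f x) * indicator B (f x + y) \<partial>lborel) \<partial>lborel)"
    by (simp add: nn_integral_cmult add.commute)
  also have "\<dots> = (\<integral>\<^sup>+y. (\<integral>\<^sup>+x. indicator A (f x) * indicator B (f x + y) \<partial>lborel) \<partial>lborel)"
    by (rule lborel_pair.Fubini') measurable
  also have "\<dots> = (\<integral>\<^sup>+y. (\<integral>\<^sup>+x. indicator A (f x - y) * indicator B (f x) \<partial>lborel) \<partial>lborel)"
  proof (rule nn_integral_cong)
    fix y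
    show "(\<integral>\<^sup>+x. indicator A (f x) * indicator B (f x + y) \<partial>lborel)
        = (\<integral>\<^sup>+x. indicator A (f x - y) * indicator B (f x) \<partial>lborel)"
      using nn_integral_lborel_shift[of "\<lambda>x. indicator A (f x - y) * indicator B (f x)" "h y"]
      by (simp add: shift)
  qed
  also have "\<dots> = (\<integral>\<^sup>+x. (\<integral>\<^sup>+y. indicator A (f x - y) * indicator B (f x) \<partial>lborel) \<partial>lborel)"
    by (rule lborel_pair.Fubini') measurable
  also have "\<dots> = (\<integral>\<^sup>+x. indicator B (f x) * (\<integral>\<^sup>+y. indicator A (f x - y) \<partial>lborel) \<partial>lborel)"
    by (simp add: nn_integral_cmult mult.commute[of "indicator A _"])
  also have "\<dots> = (\<integral>\<^sup>+x. indicator B (f x) * (\<integral>\<^sup>+y. indicator A y \<partial>lborel) \<partial>lborel)"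
    by (subst nn_integral_lborel_reflect) auto
  also have "\<dots> = emeasure lborel (f -` B) * emeasure lborel A"
    by (simp add: emeasure_vimage nn_integral_multc)
  finally show ?thesis .
qed

text \<open>Converts proportionality in product form into equality of ratios; cancelling
  \<open>b\<close> and \<open>d\<close> in \<open>ennreal\<close> requires both to be nonzero and
  finite.\<close>

lemma ennreal_divide_cross:
  fixes a b c d :: ennreal
  assumes "0 < b" "b < \<infinity>" "0 < d" "d < \<infinity>" and eq: "a * d = b * c"
  shows "a / b = c / d"
proof -
  have "a = a * d / d"
    using assms by (subst ennreal_mult_divide_eq) auto
  also have "\<dots> = c / d * b"
    by (simp add: eq ennreal_times_divide mult.commute)
  finally show ?thesis
    using assms by (simp add: ennreal_mult_divide_eq)
qed

text \<open>The constant density is that of \<open>uniform_measure lborel A\<close>, and a measure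
  is determined by its values on Borel sets. This replaces densities by ratios of volumes.\<close>

lemma uniformly_distributed_on_iff:
  assumes [measurable]: "A \<in> sets borel"
    and A: "0 < emeasure lborel A" "emeasure lborel A < \<infinity>"
  shows "uniformly_distributed_on M X A \<longleftrightarrow> X \<in> borel_measurable M \<and>
    (\<forall>C\<in>sets borel. emeasure M (X -` C \<inter> space M) = emeasure lborel (C \<inter> A) / emeasure lborel A)"
proof -
  let ?f = "\<lambda>x. ennreal (indicator A x / measure lborel A)"
  have eq: "emeasure lborel A = ennreal (measure lborel A)"
    using A by (simp add: emeasure_eq_ennreal_measure)
  have "?f x = indicator A x / emeasure lborel A" for x
    using A unfolding eq by (auto simp: indicator_def divide_ennreal simp flip: ennreal_1)
  then have density_eq: "density lborel ?f = uniform_measure lborel A"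
    by (simp add: uniform_measure_def)
  have "distr M lborel X = uniform_measure lborel A \<longleftrightarrow>
      (\<forall>C\<in>sets borel. emeasure M (X -` C \<inter> space M) = emeasure lborel (C \<inter> A) / emeasure lborel A)"
    if [measurable]: "X \<in> borel_measurable M"
  proof -
    have "distr M lborel X = uniform_measure lborel A \<longleftrightarrow>
        (\<forall>C\<in>sets borel. emeasure (distr M lborel X) C = emeasure (uniform_measure lborel A) C)"
      by (auto intro: measure_eqI)
    then show ?thesis
      by (simp add: emeasure_distr Int_commute)
  qed
  moreover have "?f \<in> borel_measurable lborel"
    by measurable
  ultimately show ?thesis
    using A by (auto simp: uniformly_distributed_on_def distributed_def density_eq)
qed

lemma uniformly_distributed_on_vimage:
  fixes f :: "'a::euclidean_space \<Rightarrow> 'b::euclidean_space"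
  assumes X: "uniformly_distributed_on M X (f -` E)"
    and f [measurable]: "f \<in> borel_measurable borel"
    and shift: "\<And>x y. f (x + h y) = f x + y"
    and E [measurable]: "E \<in> sets borel" and E_finite: "emeasure lborel E < \<infinity>"
  shows "uniformly_distributed_on M (\<lambda>\<omega>. f (X \<omega>)) E"
proof -
  let ?B = "f -` E"
  have B: "?B \<in> sets borel" "0 < emeasure lborel ?B" "emeasure lborel ?B < \<infinity>"
    using X by (auto simp: uniformly_distributed_on_def)
  \<comment> \<open>Comparing \<open>E\<close> with \<open>UNIV\<close>, the left-hand product is
    positive because the preimage of \<open>E\<close> has positive volume; so the factor
    \<open>emeasure lborel E\<close> on the right cannot be \<open>0\<close>.\<close>
  have "0 < emeasure lborel E"
    using emeasure_lborel_vimage_cross[OF f E _ shift, of UNIV] B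
    by (auto simp: zero_less_iff_neq_zero)
  note E_pos = this E_finite
  have [measurable]: "X \<in> borel_measurable M"
    and distr_X: "\<And>C. C \<in> sets borel \<Longrightarrow>
      emeasure M (X -` C \<inter> space M) = emeasure lborel (C \<inter> ?B) / emeasure lborel ?B"
    using X B by (auto simp: uniformly_distributed_on_iff)
  have "emeasure M ((\<lambda>\<omega>. f (X \<omega>)) -` C \<inter> space M) = emeasure lborel (C \<inter> E) / emeasure lborel E"
    if [measurable]: "C \<in> sets borel" for C
  proof -
    have "f -` C \<in> sets borel"
      using measurable_sets[OF f that] by simp
    then have "emeasure M ((\<lambda>\<omega>. f (X \<omega>)) -` C \<inter> space M)
        = emeasure lborel (f -` (C \<inter> E)) / emeasure lborel ?B"
      using distr_X[of "f -` C"] by (simp add: vimage_def Int_def)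
    moreover have "emeasure lborel (f -` (C \<inter> E)) * emeasure lborel E
        = emeasure lborel ?B * emeasure lborel (C \<inter> E)"
      by (rule emeasure_lborel_vimage_cross[OF _ _ _ shift]) measurable
    ultimately show ?thesis
      using ennreal_divide_cross[OF B(2,3) E_pos] by simp
  qed
  then show ?thesis
    using E_pos by (simp add: uniformly_distributed_on_iff)
qed

text \<open>With \<open>R\<close> the inverse of \<open>L ** transpose L\<close>, the product
  \<open>transpose L ** R ** L\<close> is the identity, so the quadratic form at
  \<open>L *v x\<close> is the squared norm of \<open>x\<close>.\<close>

lemma vimage_hyperellipsoid:
  fixes L :: "real ^ 'n ^ 'n"
  assumes "invertible L"
  shows "(\<lambda>x. L *v x + c) -` hyperellipsoid (L ** transpose L) c = cball 0 1"
proof -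
  have S: "invertible (L ** transpose L)"
    using assms by (simp add: invertible_mult transpose_invertible)
  define R where "R = matrix_inv (L ** transpose L)"
  have "L ** (transpose L ** R) = mat 1"
    using S unfolding R_def matrix_inv_def invertible_def matrix_mul_assoc
    by (rule someI2_ex) simp
  \<comment> \<open>For square matrices a right inverse is also a left inverse.\<close>
  then have "(transpose L ** R) ** L = mat 1"
    by (simp add: matrix_left_right_inverse)
  then have "transpose L *v (R *v (L *v x)) = x" for x
    by (simp add: matrix_vector_mul_assoc matrix_mul_assoc)
  then have "(L *v x) \<bullet> (R *v (L *v x)) = x \<bullet> x" for x
    by (metis dot_lmul_matrix inner_commute transpose_matrix_vector)
  then show ?thesis
    by (auto simp: hyperellipsoid_def R_def dot_square_norm power_le_one_iff)
qed

theorem lemma1: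
  fixes L S :: "real ^ 'n ^ 'n"
    and x_centre :: "real ^ 'n"
    and M :: "'w measure"
    and x_ball :: "'w \<Rightarrow> real ^ 'n"
  assumes "invertible L"
    and "\<not> orthogonal_matrix L"
    and "S = L ** transpose L"
    and "prob_space M"
    and "uniformly_distributed_on M x_ball {x. norm x \<le> 1}"
  shows "uniformly_distributed_on M (\<lambda>\<omega>. L *v x_ball \<omega> + x_centre) (hyperellipsoid S x_centre)"
proof -
  let ?E = "hyperellipsoid S x_centre"
  let ?f = "\<lambda>x. L *v x + x_centre"
  obtain K where K: "L ** K = mat 1"
    using \<open>invertible L\<close> by (auto simp: invertible_def)
  have cont: "continuous_on T ?f" for T
    by (intro continuous_intros)
  have "surj ?f"
    using K by (intro surjI[of _ "\<lambda>y. K *v (y - x_centre)"]) (simp add: matrix_vector_mul_assoc)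
  have vimage: "?f -` ?E = cball 0 1"
    using vimage_hyperellipsoid[OF \<open>invertible L\<close>] \<open>S = _\<close> by simp
  \<comment> \<open>Surjectivity turns the preimage equation into an image equation. The ellipsoid
    is then a continuous image of a compact ball, hence compact, which makes it Borel and of finite
    volume.\<close>
  then have image: "?f ` cball 0 1 = ?E"
    using \<open>surj ?f\<close> by (metis surj_image_vimage_eq)
  then have "compact ?E"
    using compact_continuous_image[OF cont compact_cball] by metis
  show ?thesis
  proof (rule uniformly_distributed_on_vimage[where f = ?f and h = "(*v) K"])
    show "uniformly_distributed_on M x_ball (?f -` ?E)"
      using assms(5) by (simp add: vimage cball_def dist_norm)
    show "?f (x + K *v y) = ?f x + y" for x y
      using K by (simp add: matrix_vector_right_distrib matrix_vector_mul_assoc)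
    show "?f \<in> borel_measurable borel"
      by (rule borel_measurable_continuous_onI[OF cont])
    show "?E \<in> sets borel"
      using \<open>compact ?E\<close> by (simp add: borel_compact)
    show "emeasure lborel ?E < \<infinity>"
      using emeasure_compact_finite[OF \<open>compact ?E\<close>] .
  qed
qed

end
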